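(* Let $p$ be a prime, let $n\ge 1$ be an integer, and let $j$ be a positive integer with $j\le p-1$. Then $$\zeta_{p,q,j}(n)=\frac{1}{j+(p-1)n}\left(\beta_{j+(p-1)n}(q)-[p]^{\,j+(p-1)n-1}\,\beta_{j+(p-1)n}(q^{p})\right).$$
   Context: Let $\mathbb{C}_p$ be the completion of an algebraic closure of $\mathbb{Q}_p$, with $|p|_p=1/p$. Fix $q\in\mathbb{C}_p$, $q\neq 1$, with $|q-1|_p<p^{-1/(p-1)}$; $q^x=\exp(x\log q)$ for $|x|_p\le 1$, and $[x]=[x:q]=\frac{1-q^x}{1-q}$. For a uniformly (strictly) differentiable function $g:\mathbb{Z}_p\to\mathbb{C}_p$ the $q$-Volkenborn integral is $$\int_{\mathbb{Z}_p}g(x)\,d\mu_q(x)=\lim_{N\to\infty}\frac{1}{[p^N]}\sum_{0\le i<p^N}q^{i}g(i).$$ Let $\mathbb{T}_p=\mathbb{Z}_p\setminus p\mathbb{Z}_p$, and let $\int_{\mathbb{T}_p}g\,d\mu_q=\lim_{N\to\infty}\frac{1}{[p^N]}\sum_{0\le i<p^N,\ p\nmid i}q^{i}g(i)$; equivalently, $\int_{\mathbb{T}_p}g(x)\,d\mu_q(x)=\int_{\mathbb{Z}_p}g(x)\,d\mu_q(x)-\frac{1}{[p]}\int_{\mathbb{Z}_p}g(px)\,d\mu_{q^p}(x)$. The $p$-adic $q$-Bernoulli numbers are $\beta_n(q)=\int_{\mathbb{Z}_p}q^{-x}[x]^n\,d\mu_q(x)$ for $n\ge0$; $\beta_n(q^p)$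 is the same quantity with $q$ replaced by $q^p$ (so $[x]$ becomes $[x:q^p]=\frac{1-q^{px}}{1-q^p}$). For $j\in\{0,1,\dots,p-1\}$ the $p$-adic $q$-zeta function is $$\zeta_{p,q,j}(s)=\frac{1}{j+(p-1)s}\int_{\mathbb{T}_p}q^{-x}[x]^{j}[x]^{(p-1)s}\,d\mu_q(x),\qquad s\neq-\frac{j}{p-1};$$ at a positive integer $s=n$, $[x]^{(p-1)s}$ is the ordinary power $[x]^{(p-1)n}$. *)

theory Defs
  imports Complex_Main "HOL-Computational_Algebra.Polynomial"
    "HOL-Computational_Algebra.Primes" "HOL-Analysis.Elementary_Topology"
begin

text \<open>
  The library constant \<open>norm\<close> is reserved for real normed vector spaces, so the absolute
  value of a non-archimedean field needs a name of its own.
\<close>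

class nonarch_field = field_char_0 + metric_space +
  fixes nabs :: "'a \<Rightarrow> real"
  assumes dist_nabs: "dist x y = nabs (x - y)"
    and nabs_mult: "nabs (x * y) = nabs x * nabs y"
    and nabs_ultrametric: "nabs (x + y) \<le> max (nabs x) (nabs y)"

text \<open>
  Inside a field carrying the absolute value with \<open>|p| = 1/p\<close>, the closure of the
  rationals is \<open>\<rat>\<^sub>p\<close> as soon as the field is complete.
\<close>

definition Qp :: "'a::nonarch_field set" where
  "Qp = closure \<rat>"

definition Qp_alg :: "'a::nonarch_field set" where
  "Qp_alg = {x. \<exists>P. P \<noteq> 0 \<and> (\<forall>i. coeff P i \<in> Qp) \<and> poly P x = 0}"

text \<open>
  The type \<open>'a\<close> is a model of \<open>\<complex>\<^sub>p\<close>: it is complete, and the elements algebraic over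
  \<open>\<rat>\<^sub>p\<close> form an algebraically closed field that is dense in it.  These conditions determine
  \<open>'a\<close> up to isometric isomorphism.
\<close>

definition is_Cp :: "nat \<Rightarrow> 'a::nonarch_field itself \<Rightarrow> bool" where
  "is_Cp p _ \<longleftrightarrow>
     prime p \<and> nabs (of_nat p :: 'a) = 1 / real p \<and>
     (\<forall>X :: nat \<Rightarrow> 'a. Cauchy X \<longrightarrow> convergent X) \<and>
     (\<forall>P :: 'a poly. degree P > 0 \<and> (\<forall>i. coeff P i \<in> Qp_alg) \<longrightarrow>
        (\<exists>x\<in>Qp_alg. poly P x = 0)) \<and>
     closure (Qp_alg :: 'a set) = UNIV"

definition nexp :: "'a::nonarch_field \<Rightarrow> 'a" where
  "nexp x = (\<Sum>n. x ^ n / fact n)"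

definition nlog :: "'a::nonarch_field \<Rightarrow> 'a" where
  "nlog x = (\<Sum>n. (- 1) ^ n * (x - 1) ^ Suc n / of_nat (Suc n))"

definition qpow :: "'a::nonarch_field \<Rightarrow> 'a \<Rightarrow> 'a" where
  "qpow q x = nexp (x * nlog q)"

definition qnum :: "'a::nonarch_field \<Rightarrow> 'a \<Rightarrow> 'a" where
  "qnum q x = (1 - qpow q x) / (1 - q)"

text \<open>
  For uniformly differentiable \<open>g\<close> the limit exists; otherwise \<open>lim\<close> is unspecified.
  Only the values of \<open>g\<close> at natural numbers enter.
\<close>

definition volkenborn :: "nat \<Rightarrow> 'a::nonarch_field \<Rightarrow> ('a \<Rightarrow> 'a) \<Rightarrow> 'a" where
  "volkenborn p q g =
     lim (\<lambda>N. 1 / qnum q (of_nat (p ^ N)) * (\<Sum>i | i < p ^ N. q ^ i * g (of_nat i)))"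

text \<open>Integral over \<open>\<int>\<^sub>p - p\<int>\<^sub>p\<close>.\<close>

definition volkenborn_units :: "nat \<Rightarrow> 'a::nonarch_field \<Rightarrow> ('a \<Rightarrow> 'a) \<Rightarrow> 'a" where
  "volkenborn_units p q g =
     lim (\<lambda>N. 1 / qnum q (of_nat (p ^ N)) *
       (\<Sum>i | i < p ^ N \<and> \<not> p dvd i. q ^ i * g (of_nat i)))"

definition qbernoulli :: "nat \<Rightarrow> 'a::nonarch_field \<Rightarrow> nat \<Rightarrow> 'a" where
  "qbernoulli p q n = volkenborn p q (\<lambda>x. qpow q (- x) * qnum q x ^ n)"

text \<open>
  The power \<open>y\<^sup>s\<close> with exponent \<open>s\<close> in the field, as the binomial series.  For
  \<open>|y - 1| < 1\<close> and \<open>s \<in> \<int>\<^sub>p\<close> it is the continuous interpolation of the ordinary powers.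
  The definition by \<open>nexp (s * nlog y)\<close> would be wrong for \<open>p = 2\<close>: in \<open>\<rat>\<^sub>2\<close>
  one has \<open>nexp (nlog 3) = - 3\<close>.
\<close>

definition binpow :: "'a::nonarch_field \<Rightarrow> 'a \<Rightarrow> 'a" where
  "binpow y s = (\<Sum>k. (s gchoose k) * (y - 1) ^ k)"

lemma binpow_of_nat: "binpow y (of_nat n) = y ^ n"
proof -
  have "binpow y (of_nat n) = (\<Sum>k\<le>n. (of_nat n gchoose k) * (y - 1) ^ k)"
    unfolding binpow_def
    by (rule suminf_finite) (auto simp: binomial_gbinomial[symmetric] binomial_eq_0)
  also have "\<dots> = ((y - 1) + 1) ^ n"
    by (simp only: binomial_ring binomial_gbinomial power_one mult_1_right)
  finally show ?thesis by simp
qed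

text \<open>Here \<open>[x]\<^bsup>(p-1)s\<^esup>\<close> is read as \<open>([x]\<^bsup>p-1\<^esup>)\<^bsup>s\<^esup>\<close>, with \<open>[x]\<^bsup>p-1\<^esup>\<close> close to 1.\<close>

definition qzeta :: "nat \<Rightarrow> 'a::nonarch_field \<Rightarrow> nat \<Rightarrow> 'a \<Rightarrow> 'a" where
  "qzeta p q j s =
     1 / (of_nat j + of_nat (p - 1) * s) *
     volkenborn_units p q
       (\<lambda>x. qpow q (- x) * qnum q x ^ j * binpow (qnum q x ^ (p - 1)) s)"

end

theory Submission
  imports Defs
begin

text \<open>
  Write \<open>m = j + (p - 1) n\<close> and \<open>[i] = (1 - q\<^sup>i) / (1 - q)\<close>.  At a natural number \<open>i\<close> the factors
  \<open>q\<^sup>i\<close> and \<open>q\<^bsup>-i\<^esup>\<close> cancel, so all three integrals are limits of normalised sums of \<open>[i]\<^sup>m\<close>.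
  The sum over the \<open>i < p\<^bsup>N+1\<^esup>\<close> prime to \<open>p\<close> is the full sum minus the sum over the multiples
  of \<open>p\<close>, and \<open>[p i] = [p] [i : q\<^sup>p]\<close> rewrites the latter as a sum for \<open>q\<^sup>p\<close>.  This gives the
  identity exactly at every level \<open>N\<close> (\<open>units_sum_eq\<close>).  The limit may be taken termwise because
  both Bernoulli limits exist (\<open>qbernoulli_LIMSEQ\<close>): expanding \<open>[i]\<^sup>m\<close> in powers of \<open>q\<^sup>i\<close> leaves
  geometric sums, and everything reduces to the existence of a nonzero limit of
  \<open>(q\<^bsup>p^N\<^esup> - 1) / p\<^sup>N\<close>, which is \<open>log q\<close>.

  Since \<open>q\<^sup>x\<close> is defined as \<open>exp (x log q)\<close>, the cancellation rests on the functional equation of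
  \<open>exp\<close> (\<open>nexp_add\<close>) and on \<open>exp (log q) = q\<close> (\<open>nexp_nlog\<close>).  Both hold in the disc of radius
  \<open>p\<^bsup>-1/(p-1)\<^esup>\<close>, where the bound \<open>nabs_fact_ge\<close> on \<open>n!\<close> controls both series.  To obtain
  \<open>exp (log q) = q\<close>, compare \<open>a\<close>-th powers for \<open>a = p\<^sup>N\<close>: both \<open>q\<^sup>a\<close> and \<open>exp (a log q)\<close> equal
  \<open>1 + a log q\<close> up to an error of size \<open>|a|\<^sup>2\<close> (\<open>nlog_expansion\<close>, \<open>nexp_expansion\<close>), too small
  to leave room for a quotient \<open>q / exp (log q)\<close> other than \<open>1\<close>.
\<close>

section \<open>Non-archimedean absolute values\<close>

lemma nabs_0 [simp]: "nabs (0 :: 'a::nonarch_field) = 0"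
  using dist_nabs[of 0 "0::'a"] by simp

lemma nabs_eq_0_iff [simp]: "nabs (x :: 'a::nonarch_field) = 0 \<longleftrightarrow> x = 0"
  using dist_nabs[of x 0] by auto

lemma nabs_nonneg [simp]: "0 \<le> nabs (x :: 'a::nonarch_field)"
  using dist_nabs[of x 0] by (metis diff_zero zero_le_dist)

lemma nabs_pos: "x \<noteq> 0 \<Longrightarrow> 0 < nabs (x :: 'a::nonarch_field)"
  using nabs_nonneg[of x] nabs_eq_0_iff[of x] by linarith

lemma nabs_1 [simp]: "nabs (1 :: 'a::nonarch_field) = 1"
  using nabs_mult[of 1 "1::'a"] by auto

lemma nabs_minus [simp]: "nabs (- x :: 'a::nonarch_field) = nabs x"
  by (metis diff_0 diff_zero dist_commute dist_nabs)

lemma nabs_power: "nabs (x ^ n :: 'a::nonarch_field) = nabs x ^ n"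
  by (induction n) (auto simp: nabs_mult)

lemma nabs_divide: "nabs (x / y :: 'a::nonarch_field) = nabs x / nabs y"
proof (cases "y = 0")
  case False
  have "nabs x = nabs (x / y) * nabs y"
    using False by (simp flip: nabs_mult)
  with False show ?thesis by (simp add: field_simps)
qed auto

lemma nabs_add_le: "nabs x \<le> B \<Longrightarrow> nabs y \<le> B \<Longrightarrow> nabs (x + y :: 'a::nonarch_field) \<le> B"
  using nabs_ultrametric[of x y] by linarith

lemma nabs_diff_le: "nabs x \<le> B \<Longrightarrow> nabs y \<le> B \<Longrightarrow> nabs (x - y :: 'a::nonarch_field) \<le> B"
  using nabs_add_le[of x B "- y"] by simp

lemma nabs_sum_le:
  fixes f :: "'b \<Rightarrow> 'a::nonarch_field"
  assumes "0 \<le> B" "\<And>i. i \<in> A \<Longrightarrow> nabs (f i) \<le> B"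
  shows "nabs (sum f A) \<le> B"
  using assms by (induction A rule: infinite_finite_induct) (auto intro: nabs_add_le)

lemma nabs_of_nat_le_1: "nabs (of_nat n :: 'a::nonarch_field) \<le> 1"
  by (induction n) (auto intro: nabs_add_le)

text \<open>
  The isosceles triangle principle.  It shows that units stay units under small perturbations,
  and that the terms of a convergent sequence eventually have the absolute value of its
  nonzero limit.
\<close>

lemma nabs_eq_if_close:
  fixes x y :: "'a::nonarch_field"
  assumes "nabs (x - y) < nabs y"
  shows "nabs x = nabs y"
  using nabs_ultrametric[of "x - y" y] nabs_ultrametric[of "y - x" x] assms
    nabs_minus[of "x - y"] by simp

lemma tendsto_nabs_iff:
  fixes l :: "'a::nonarch_field"
  shows "(f \<longlongrightarrow> l) F \<longleftrightarrow> ((\<lambda>x. nabs (f x - l)) \<longlongrightarrow> 0) F"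
  using tendsto_dist_iff[of f l F] by (simp add: dist_nabs)

lemma tendsto_nabs_squeeze:
  fixes l :: "'a::nonarch_field"
  assumes "(g \<longlongrightarrow> 0) F" "\<forall>\<^sub>F x in F. nabs (f x - l) \<le> g x"
  shows "(f \<longlongrightarrow> l) F"
  unfolding tendsto_nabs_iff
  by (rule tendsto_sandwich[OF _ assms(2) tendsto_const assms(1)]) simp

text \<open>
  Field operations are continuous, so the library theory of limits and series in
  topological groups and monoids applies.
\<close>

instance nonarch_field \<subseteq> topological_ab_group_add
proof
  fix a b :: 'a
  have "((\<lambda>z. nabs (fst z - a) + nabs (snd z - b)) \<longlongrightarrow> 0 + 0) (nhds a \<times>\<^sub>F nhds b)"
    by (intro tendsto_add; unfold tendsto_nabs_iff[symmetric])
       (auto intro: filterlim_fst filterlim_snd)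
  then show "LIM z (nhds a \<times>\<^sub>F nhds b). fst z + snd z :> nhds (a + b)"
  proof (rule tendsto_nabs_squeeze[OF tendsto_eq_rhs], simp, intro always_eventually allI)
    fix z :: "'a \<times> 'a"
    have "nabs ((fst z - a) + (snd z - b)) \<le> nabs (fst z - a) + nabs (snd z - b)"
      by (intro nabs_add_le) auto
    then show "nabs ((fst z + snd z) - (a + b)) \<le> nabs (fst z - a) + nabs (snd z - b)"
      by (simp add: algebra_simps)
  qed
next
  fix a :: 'a
  have "nabs (- x - - a) = nabs (x - a)" for x
    using nabs_minus[of "x - a"] by simp
  then show "(uminus \<longlongrightarrow> - a) (nhds a)"
    using filterlim_ident[of "nhds a"] by (simp add: tendsto_nabs_iff)
qed

instance nonarch_field \<subseteq> topological_comm_monoid_mult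
proof
  fix a b :: 'a
  let ?F = "nhds a \<times>\<^sub>F nhds b"
  have 1: "((\<lambda>z. nabs (fst z - a)) \<longlongrightarrow> 0) ?F" "((\<lambda>z. nabs (snd z - b)) \<longlongrightarrow> 0) ?F"
    by (unfold tendsto_nabs_iff[symmetric]) (auto intro: filterlim_fst filterlim_snd)
  have "((\<lambda>z. nabs (fst z - a) * nabs (snd z - b) + nabs a * nabs (snd z - b)
           + nabs b * nabs (fst z - a)) \<longlongrightarrow> 0 * 0 + nabs a * 0 + nabs b * 0) ?F"
    by (intro tendsto_add tendsto_mult tendsto_const 1)
  then show "LIM z ?F. fst z * snd z :> nhds (a * b)"
  proof (rule tendsto_nabs_squeeze[OF tendsto_eq_rhs], simp, intro always_eventually allI)
    fix z :: "'a \<times> 'a"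
    have "fst z * snd z - a * b =
        (fst z - a) * (snd z - b) + a * (snd z - b) + b * (fst z - a)"
      by (simp add: algebra_simps)
    also have "nabs \<dots> \<le> nabs (fst z - a) * nabs (snd z - b) + nabs a * nabs (snd z - b)
        + nabs b * nabs (fst z - a)"
      by (intro nabs_add_le; simp add: nabs_mult)
    finally show "nabs (fst z * snd z - a * b) \<le> nabs (fst z - a) * nabs (snd z - b)
        + nabs a * nabs (snd z - b) + nabs b * nabs (fst z - a)" .
  qed
qed

lemma tendsto_inverse_nonarch:
  fixes l :: "'a::nonarch_field"
  assumes f: "(f \<longlongrightarrow> l) F" and l: "l \<noteq> 0"
  shows "((\<lambda>x. inverse (f x)) \<longlongrightarrow> inverse l) F"
proof (rule tendsto_nabs_squeeze)
  have lim: "((\<lambda>x. nabs (f x - l)) \<longlongrightarrow> 0) F"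
    using f by (simp add: tendsto_nabs_iff)
  then show "((\<lambda>x. nabs (f x - l) / nabs l ^ 2) \<longlongrightarrow> 0) F"
    by (rule tendsto_divide_zero)
  have "\<forall>\<^sub>F x in F. nabs (f x - l) < nabs l"
    using order_tendstoD(2)[OF lim nabs_pos[OF l]] .
  then show "\<forall>\<^sub>F x in F. nabs (inverse (f x) - inverse l) \<le> nabs (f x - l) / nabs l ^ 2"
  proof eventually_elim
    case (elim x)
    then have eq: "nabs (f x) = nabs l" by (rule nabs_eq_if_close)
    with l have "f x \<noteq> 0" by auto
    with l have "inverse (f x) - inverse l = - ((f x - l) / (f x * l))"
      by (simp add: field_simps)
    then show ?case
      using eq by (simp add: nabs_divide nabs_mult power2_eq_square)
  qed
qed

lemma sums_nabs_le:
  fixes s :: "'a::nonarch_field"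
  assumes "f sums s" "\<And>n. nabs (f n) \<le> B"
  shows "nabs s \<le> B"
proof (rule ccontr)
  assume "\<not> nabs s \<le> B"
  have "0 \<le> B" using assms(2)[of 0] nabs_nonneg order_trans by blast
  with \<open>\<not> nabs s \<le> B\<close> have "0 < nabs s" by simp
  with assms(1) obtain n where n: "nabs (sum f {..<n} - s) < nabs s"
    using LIMSEQ_D unfolding sums_def
    by (metis (no_types, lifting) dist_nabs lim_sequentially order_refl)
  then have "nabs (sum f {..<n}) = nabs s" by (rule nabs_eq_if_close)
  moreover have "nabs (sum f {..<n}) \<le> B"
    using \<open>0 \<le> B\<close> assms(2) by (intro nabs_sum_le)
  ultimately show False using \<open>\<not> nabs s \<le> B\<close> by simp
qed

section \<open>Complete fields of residue characteristic \<open>p\<close>\<close>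

text \<open>
  The complete extensions of \<open>\<rat>\<^sub>p\<close>, with the absolute value extending the \<open>p\<close>-adic one.
\<close>

locale complete_padic_field =
  fixes p :: nat and ty :: "'a::nonarch_field itself"
  assumes prime_p: "prime p"
    and nabs_p: "nabs (of_nat p :: 'a) = 1 / real p"
    and complete: "Cauchy (X :: nat \<Rightarrow> 'a) \<Longrightarrow> convergent X"
begin

lemma p_gt_1: "1 < p"
  using prime_p by (rule prime_gt_1_nat)

lemma summable_if_tendsto_0:
  fixes f :: "nat \<Rightarrow> 'a"
  assumes "(\<lambda>n. nabs (f n)) \<longlonglongrightarrow> 0"
  shows "summable f"
proof -
  have "Cauchy (\<lambda>n. sum f {..<n})"
    unfolding Cauchy_altdef
  proof (intro allI impI)
    fix e :: real assume "0 < e"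
    then have "\<forall>\<^sub>F n in sequentially. nabs (f n) < e / 2"
      by (intro order_tendstoD(2)[OF assms]) simp
    then obtain M where M: "\<And>n. M \<le> n \<Longrightarrow> nabs (f n) < e / 2"
      by (auto simp: eventually_sequentially)
    have "dist (sum f {..<m}) (sum f {..<n}) < e" if "M \<le> m" "m < n" for m n
    proof -
      have "sum f {..<n} - sum f {..<m} = sum f {m..<n}"
        using sum_diff_nat_ivl[of 0 m n f] \<open>m < n\<close> by (simp add: atLeast0LessThan)
      moreover have "nabs (sum f {m..<n}) \<le> e / 2"
        using M that \<open>0 < e\<close> by (intro nabs_sum_le) (auto intro!: less_imp_le)
      ultimately show ?thesis
        using \<open>0 < e\<close> by (subst dist_commute) (simp add: dist_nabs)
    qed
    then show "\<exists>M. \<forall>m\<ge>M. \<forall>n>m. dist (sum f {..<m}) (sum f {..<n}) < e" by blast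
  qed
  then show ?thesis
    by (simp add: complete summable_iff_convergent)
qed

lemma nabs_of_nat_coprime:
  assumes "\<not> p dvd n"
  shows "nabs (of_nat n :: 'a) = 1"
proof -
  have "coprime n p"
    using assms prime_p by (meson coprime_commute prime_imp_coprime)
  then obtain a b where ab: "a * n = b * p + 1"
    using coprime_bezout_strong[of n p] p_gt_1 by (auto simp: mult.commute)
  have "1 = (of_nat a * of_nat n - of_nat b * of_nat p :: 'a)"
    using arg_cong[OF ab, of "of_nat :: nat \<Rightarrow> 'a"] by simp
  moreover have "nabs (of_nat b * of_nat p :: 'a) \<le> 1 / real p"
    using nabs_of_nat_le_1[of b, where 'a = 'a] by (simp add: nabs_mult nabs_p divide_right_mono)
  moreover have "nabs (of_nat a * of_nat n :: 'a) \<le> nabs (of_nat n :: 'a)"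
    using nabs_of_nat_le_1[of a, where 'a = 'a] by (simp add: nabs_mult mult_left_le_one_le)
  ultimately have "nabs (1 :: 'a) \<le> max (nabs (of_nat n :: 'a)) (1 / real p)"
    using nabs_diff_le[of "of_nat a * of_nat n :: 'a" _ "of_nat b * of_nat p"] by force
  then show ?thesis
    using p_gt_1 nabs_of_nat_le_1[of n, where 'a = 'a] by (auto simp: max_def split: if_splits)
qed

definition \<rho> :: real where "\<rho> = real p powr (- 1 / (real p - 1))"

lemma rho_pos: "0 < \<rho>"
  using p_gt_1 by (simp add: \<rho>_def)

lemma rho_power: "\<rho> ^ (p - 1) = 1 / real p"
proof -
  have "\<rho> ^ (p - 1) = \<rho> powr real (p - 1)"
    using rho_pos by (simp add: powr_realpow)
  also have "\<dots> = real p powr (- 1 / (real p - 1) * real (p - 1))"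
    unfolding \<rho>_def by (rule powr_powr)
  also have "- 1 / (real p - 1) * real (p - 1) = - 1"
    using p_gt_1 by (simp add: of_nat_diff)
  finally show ?thesis using p_gt_1 by (simp add: powr_minus_divide)
qed

lemma rho_lt_1: "\<rho> < 1"
  using p_gt_1 by (simp add: \<rho>_def powr_less_one)

text \<open>
  Only the multiples of \<open>p\<close> among \<open>1, \<dots>, n\<close> contribute; dividing each of them by \<open>p\<close> leaves
  the factorial of \<open>n div p\<close>.
\<close>

lemma nabs_fact: "nabs (fact n :: 'a) = (1 / real p) ^ (n div p) * nabs (fact (n div p) :: 'a)"
proof (induction n)
  case (Suc n)
  show ?case
  proof (cases "p dvd Suc n")
    case True
    then have div: "Suc n div p = Suc (n div p)" by (simp add: div_Suc dvd_eq_mod_eq_0)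
    have "Suc n = p * Suc (n div p)"
      using dvd_mult_div_cancel[OF True] div by simp
    then have "nabs (of_nat (Suc n) :: 'a) = 1 / real p * nabs (of_nat (Suc (n div p)) :: 'a)"
      by (metis nabs_mult nabs_p of_nat_mult)
    then show ?thesis
      unfolding div fact_Suc[of n] fact_Suc[of "n div p"] nabs_mult Suc by simp
  next
    case False
    then show ?thesis
      using Suc by (auto simp: div_Suc nabs_mult nabs_of_nat_coprime dvd_eq_mod_eq_0
          simp del: of_nat_Suc)
  qed
qed auto

text \<open>
  The bound \<open>v(n!) \<le> (n - 1) / (p - 1)\<close> behind the radius of convergence \<open>\<rho>\<close>: by
  \<open>\<rho>\<^bsup>p - 1\<^esup> = 1/p\<close>, passing from \<open>n div p\<close> to \<open>n\<close> costs \<open>\<rho>\<^bsup>(p - 1) (n div p)\<^esup>\<close>.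
\<close>

lemma nabs_fact_ge: "\<rho> ^ n \<le> nabs (fact (Suc n) :: 'a)"
proof (induction n rule: less_induct)
  case (less n)
  define m where "m = Suc n div p"
  show ?case
  proof (cases m)
    case 0
    then have "nabs (fact (Suc n) :: 'a) = 1"
      using nabs_fact[of "Suc n"] by (simp add: m_def)
    then show ?thesis using rho_pos rho_lt_1 by (simp add: power_le_one)
  next
    case (Suc k)
    have le: "p * Suc k \<le> Suc n"
      using Suc by (metis m_def mult.commute div_times_less_eq_dividend)
    moreover have "2 * Suc k \<le> p * Suc k"
      using p_gt_1 by (intro mult_right_mono) auto
    ultimately have "2 * Suc k \<le> Suc n" by (rule order_trans[rotated])
    then have "k < n" by simp
    have "(p - 1) * Suc k + k \<le> n"
    proof -
      have "Suc ((p - 1) * Suc k + k) = p * Suc k"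
        using p_gt_1 by (cases p) auto
      with le show ?thesis by simp
    qed
    then have "\<rho> ^ n \<le> \<rho> ^ ((p - 1) * Suc k + k)"
      using rho_pos rho_lt_1 by (intro power_decreasing) auto
    also have "\<dots> = (1 / real p) ^ Suc k * \<rho> ^ k"
      by (simp only: power_add power_mult rho_power)
    also have "\<dots> \<le> (1 / real p) ^ Suc k * nabs (fact (Suc k) :: 'a)"
      using less[OF \<open>k < n\<close>] by (intro mult_left_mono) auto
    also have "\<dots> = nabs (fact (Suc n) :: 'a)"
      using nabs_fact[of "Suc n"] Suc by (simp add: m_def)
    finally show ?thesis .
  qed
qed

section \<open>Exponential and logarithm\<close>

text \<open>
  The geometric decay in \<open>|x| / \<rho>\<close> governs the exponential and, since \<open>|n!| \<le> |n|\<close>, also the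
  logarithm.  The factor \<open>|x|\<close> in front makes the linear term dominate.
\<close>

lemma nabs_exp_term_le:
  fixes x :: 'a
  shows "nabs (x ^ Suc n / fact (Suc n)) \<le> nabs x * (nabs x / \<rho>) ^ n"
proof -
  have "nabs (x ^ Suc n / fact (Suc n)) = nabs x * nabs x ^ n / nabs (fact (Suc n) :: 'a)"
    by (simp only: nabs_divide nabs_mult nabs_power power_Suc)
  also have "\<dots> \<le> nabs x * nabs x ^ n / \<rho> ^ n"
    using nabs_fact_ge[of n] rho_pos
    by (intro divide_left_mono mult_pos_pos nabs_pos) (auto simp del: fact_Suc)
  finally show ?thesis by (simp add: power_divide)
qed

lemma nabs_exp_term_le_power:
  fixes x :: 'a
  assumes "nabs x < \<rho>"
  shows "nabs (x ^ n / fact n) \<le> (nabs x / \<rho>) ^ n"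
proof (cases n)
  case (Suc k)
  have "nabs x \<le> nabs x / \<rho>"
    using rho_pos rho_lt_1 by (simp add: pos_le_divide_eq mult_left_le)
  then have "nabs x * (nabs x / \<rho>) ^ k \<le> nabs x / \<rho> * (nabs x / \<rho>) ^ k"
    using rho_pos by (intro mult_right_mono) auto
  with nabs_exp_term_le[of x k] Suc show ?thesis by simp
qed simp

lemma nabs_exp_term_le_1:
  fixes x :: 'a
  assumes "nabs x < \<rho>"
  shows "nabs (x ^ n / fact n) \<le> 1"
  using nabs_exp_term_le_power[OF assms, of n] assms rho_pos
  by (smt (verit, best) divide_less_eq_1_pos nabs_nonneg divide_nonneg_pos power_le_one)

lemma nexp_sums:
  fixes x :: 'a
  assumes "nabs x < \<rho>"
  shows "(\<lambda>n. x ^ n / fact n) sums nexp x"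
proof -
  have "(\<lambda>n. (nabs x / \<rho>) ^ n) \<longlonglongrightarrow> 0"
    using assms rho_pos by (intro LIMSEQ_realpow_zero) auto
  then have "(\<lambda>n. x ^ n / fact n) \<longlonglongrightarrow> 0"
    by (rule tendsto_nabs_squeeze) (simp add: nabs_exp_term_le_power[OF assms])
  then show ?thesis
    unfolding nexp_def by (intro summable_sums summable_if_tendsto_0) (simp add: tendsto_nabs_iff)
qed

lemma nexp_0 [simp]: "nexp (0 :: 'a) = 1"
proof -
  have "(\<lambda>n. (0 :: 'a) ^ n / fact n) = (\<lambda>n. if n = 0 then 1 else 0)" by auto
  moreover have "(\<lambda>n. if n = 0 then 1 else 0 :: 'a) sums 1"
    using sums_If_finite[of "\<lambda>n. n = 0" "\<lambda>_. 1 :: 'a"] by simp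
  ultimately show ?thesis unfolding nexp_def by (metis sums_unique)
qed

text \<open>
  The partial sums satisfy \<open>S\<^sub>M(x) S\<^sub>M(y) - S\<^sub>M(x + y) = \<Sum> x\<^sup>i/i! y\<^sup>j/j!\<close>, summed over the
  pairs with \<open>i, j < M \<le> i + j\<close>.  By the ultrametric inequality this is no larger than its
  largest term.
\<close>

lemma nexp_add:
  fixes x y :: 'a
  assumes x: "nabs x < \<rho>" and y: "nabs y < \<rho>"
  shows "nexp (x + y) = nexp x * nexp y"
proof -
  define a where "a x n = x ^ n / fact n" for x :: 'a and n
  define \<sigma> where "\<sigma> = max (nabs x) (nabs y) / \<rho>"
  have \<sigma>: "0 \<le> \<sigma>" "\<sigma> < 1" "nabs x / \<rho> \<le> \<sigma>" "nabs y / \<rho> \<le> \<sigma>"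
    using x y rho_pos by (auto simp: \<sigma>_def divide_right_mono le_max_iff_disj)
  have xy: "nabs (x + y) < \<rho>"
    using nabs_ultrametric[of x y] x y by linarith
  have ax: "nabs (a x i) \<le> \<sigma> ^ i" for i
    using nabs_exp_term_le_power[OF x, of i] power_mono[OF \<sigma>(3), of i] rho_pos
    by (simp add: a_def)
  have ay: "nabs (a y i) \<le> \<sigma> ^ i" for i
    using nabs_exp_term_le_power[OF y, of i] power_mono[OF \<sigma>(4), of i] rho_pos
    by (simp add: a_def)
  have a_add: "a (x + y) n = (\<Sum>i\<le>n. a x i * a y (n - i))" for n
  proof -
    have "of_nat (n choose i) / fact n = (1 / (fact i * fact (n - i)) :: 'a)" if "i \<le> n" for i
      using binomial_fact[OF that, where 'a = 'a] by simp
    then have "of_nat (n choose i) * x ^ i * y ^ (n - i) / fact n = a x i * a y (n - i)"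
      if "i \<le> n" for i
      using that by (simp add: a_def field_simps)
    then show ?thesis
      by (simp add: a_def[of "x + y"] binomial_ring sum_divide_distrib)
  qed
  have "(\<lambda>M. sum (a x) {..<M} * sum (a y) {..<M} - sum (a (x + y)) {..<M}) \<longlonglongrightarrow> 0"
  proof (rule tendsto_nabs_squeeze[where g = "\<lambda>M. \<sigma> ^ M"])
    show "(\<lambda>M. \<sigma> ^ M) \<longlonglongrightarrow> 0" using \<sigma> by (intro LIMSEQ_realpow_zero)
    show "\<forall>\<^sub>F M in sequentially.
      nabs (sum (a x) {..<M} * sum (a y) {..<M} - sum (a (x + y)) {..<M} - 0) \<le> \<sigma> ^ M"
    proof (intro always_eventually allI)
      fix M :: nat
      let ?Q = "{..<M} \<times> {..<M}" and ?T = "{(i,j). i + j < M}"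
      have "?T \<subseteq> ?Q" by auto
      have "sum (a (x + y)) {..<M} = (\<Sum>(i,j)\<in>?T. a x i * a y j)"
        by (simp add: a_add sum.triangle_reindex)
      moreover have "sum (a x) {..<M} * sum (a y) {..<M} = (\<Sum>(i,j)\<in>?Q. a x i * a y j)"
        by (simp add: sum_product sum.cartesian_product)
      ultimately have "sum (a x) {..<M} * sum (a y) {..<M} - sum (a (x + y)) {..<M}
          = (\<Sum>(i,j)\<in>?Q - ?T. a x i * a y j)"
        using \<open>?T \<subseteq> ?Q\<close> by (simp add: sum_diff)
      moreover have "nabs (\<Sum>(i,j)\<in>?Q - ?T. a x i * a y j) \<le> \<sigma> ^ M"
      proof (rule nabs_sum_le)
        fix ij assume "ij \<in> ?Q - ?T"
        then obtain i j where ij: "ij = (i, j)" "M \<le> i + j" by fastforce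
        have "nabs (a x i * a y j) \<le> \<sigma> ^ i * \<sigma> ^ j"
          unfolding nabs_mult using ax ay \<sigma> by (intro mult_mono) auto
        also have "\<dots> \<le> \<sigma> ^ M"
          using ij \<sigma> by (simp flip: power_add add: power_decreasing)
        finally show "nabs (case ij of (i, j) \<Rightarrow> a x i * a y j) \<le> \<sigma> ^ M"
          using ij by simp
      qed (use \<sigma> in auto)
      ultimately show "nabs (sum (a x) {..<M} * sum (a y) {..<M} - sum (a (x + y)) {..<M} - 0)
        \<le> \<sigma> ^ M" by simp
    qed
  qed
  moreover have "(\<lambda>M. sum (a x) {..<M} * sum (a y) {..<M} - sum (a (x + y)) {..<M})
      \<longlonglongrightarrow> nexp x * nexp y - nexp (x + y)"
    using nexp_sums[OF x] nexp_sums[OF y] nexp_sums[OF xy] unfolding sums_def a_def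
    by (intro tendsto_diff tendsto_mult)
  ultimately show ?thesis using LIMSEQ_unique by fastforce
qed

lemma nabs_of_nat_mult_le: "nabs (of_nat i * x :: 'a) \<le> nabs x"
  using nabs_of_nat_le_1[of i, where 'a = 'a] by (simp add: nabs_mult mult_left_le_one_le)

lemma nexp_of_nat_mult:
  fixes x :: 'a
  assumes "nabs x < \<rho>"
  shows "nexp (of_nat i * x) = nexp x ^ i"
proof (induction i)
  case (Suc i)
  have "nabs (of_nat i * x) < \<rho>"
    using nabs_of_nat_mult_le[of i x] assms by linarith
  then show ?case
    using nexp_add[OF assms, of "of_nat i * x"] Suc by (simp add: algebra_simps)
qed simp

lemma nexp_minus:
  fixes x :: 'a
  assumes "nabs x < \<rho>"
  shows "nexp (- x) * nexp x = 1"
  using nexp_add[of "- x" x] assms by simp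

lemma nlog_term_eq:
  fixes t :: 'a
  shows "(-1) ^ n * t ^ Suc n / of_nat (Suc n) = (-1) ^ n * fact n * (t ^ Suc n / fact (Suc n))"
  by (simp add: field_simps del: of_nat_Suc)

lemma nabs_fact_le_1: "nabs (fact n :: 'a) \<le> 1"
  using nabs_of_nat_le_1[of "fact n", where 'a = 'a] by simp

lemma nabs_nlog_term_le:
  fixes t :: 'a
  shows "nabs ((-1) ^ n * t ^ Suc n / of_nat (Suc n)) \<le> nabs t * (nabs t / \<rho>) ^ n"
proof -
  have "nabs ((-1) ^ n * t ^ Suc n / of_nat (Suc n)) =
      nabs (fact n :: 'a) * nabs (t ^ Suc n / fact (Suc n))"
    unfolding nlog_term_eq nabs_mult nabs_power by simp
  also have "\<dots> \<le> nabs (t ^ Suc n / fact (Suc n))"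
    using nabs_fact_le_1 by (intro mult_left_le_one_le) auto
  finally show ?thesis using nabs_exp_term_le[of t n] by linarith
qed

lemma nlog_sums:
  fixes y :: 'a
  assumes "nabs (y - 1) < \<rho>"
  shows "(\<lambda>n. (-1) ^ n * (y - 1) ^ Suc n / of_nat (Suc n)) sums nlog y"
proof -
  let ?s = "nabs (y - 1) / \<rho>"
  have "(\<lambda>n. nabs (y - 1) * ?s ^ n) \<longlonglongrightarrow> nabs (y - 1) * 0"
    using assms rho_pos by (intro tendsto_mult_left LIMSEQ_realpow_zero) auto
  then have "(\<lambda>n. nabs (y - 1) * ?s ^ n) \<longlonglongrightarrow> 0" by simp
  then have "(\<lambda>n. (-1) ^ n * (y - 1) ^ Suc n / of_nat (Suc n)) \<longlonglongrightarrow> 0"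
    by (rule tendsto_nabs_squeeze)
       (unfold diff_zero, intro always_eventually allI nabs_nlog_term_le)
  then show ?thesis
    unfolding nlog_def by (intro summable_sums summable_if_tendsto_0) (simp add: tendsto_nabs_iff)
qed

lemma nabs_nlog_le:
  fixes y :: 'a
  assumes "nabs (y - 1) < \<rho>"
  shows "nabs (nlog y) \<le> nabs (y - 1)"
proof (rule sums_nabs_le[OF nlog_sums[OF assms]])
  fix n
  have "(nabs (y - 1) / \<rho>) ^ n \<le> 1"
    using assms rho_pos by (intro power_le_one) auto
  then show "nabs ((-1) ^ n * (y - 1) ^ Suc n / of_nat (Suc n)) \<le> nabs (y - 1)"
    using nabs_nlog_term_le[of n "y - 1"] mult_left_le[of _ "nabs (y - 1)"] by fastforce
qed

text \<open>The linear term of the logarithm series strictly dominates all others.\<close>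

lemma nlog_eq_0_imp:
  fixes y :: 'a
  assumes "nabs (y - 1) < \<rho>" "nlog y = 0"
  shows "y = 1"
proof (rule ccontr)
  assume "y \<noteq> 1"
  define t where "t = y - 1"
  have t: "nabs t < \<rho>" "0 < nabs t" using assms(1) nabs_pos[of t] \<open>y \<noteq> 1\<close> by (simp_all add: t_def)
  let ?f = "\<lambda>n. (-1) ^ n * t ^ Suc n / of_nat (Suc n)"
  have "(\<lambda>n. ?f n + (if n = 0 then - t else 0)) sums (nlog y + - t)"
    using nlog_sums[OF assms(1)] sums_If_finite[of "\<lambda>n. n = 0" "\<lambda>_. - t"]
    by (intro sums_add) (auto simp: t_def)
  then have "nabs (nlog y + - t) \<le> nabs t * (nabs t / \<rho>)"
  proof (rule sums_nabs_le)
    fix n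
    show "nabs (?f n + (if n = 0 then - t else 0)) \<le> nabs t * (nabs t / \<rho>)"
    proof (cases n)
      case (Suc k)
      have "(nabs t / \<rho>) ^ n \<le> nabs t / \<rho>"
        using t rho_pos Suc power_decreasing[of 1 n "nabs t / \<rho>"] by simp
      then have "nabs t * (nabs t / \<rho>) ^ n \<le> nabs t * (nabs t / \<rho>)"
        by (intro mult_left_mono) auto
      then show ?thesis using nabs_nlog_term_le[of n t] Suc by simp
    qed (use rho_pos in simp)
  qed
  also have "\<dots> < nabs t * 1"
    using t rho_pos by (intro mult_strict_left_mono) auto
  finally show False using assms by simp
qed

text \<open>
  From the quadratic one on, every term \<open>a\<^sup>n x\<^sup>n / n!\<close> of the series is \<open>a\<^sup>2\<close> times something of
  absolute value at most \<open>1\<close>.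
\<close>

lemma nexp_expansion:
  fixes x :: 'a
  assumes "nabs x < \<rho>"
  shows "nabs (nexp (of_nat a * x) - 1 - of_nat a * x) \<le> nabs (of_nat a :: 'a) ^ 2"
proof -
  let ?x = "of_nat a * x" and ?g = "\<lambda>n. if n = 0 then - 1 else if n = 1 then - (of_nat a * x) else 0"
  have "nabs ?x < \<rho>" using nabs_of_nat_mult_le[of a x] assms by linarith
  moreover have "?g sums (- 1 - ?x)"
    using sums_finite[of "{0, 1}" ?g] by simp
  ultimately have "(\<lambda>n. ?x ^ n / fact n + ?g n) sums (nexp ?x + (- 1 - ?x))"
    by (intro sums_add nexp_sums)
  then have "nabs (nexp ?x + (- 1 - ?x)) \<le> nabs (of_nat a :: 'a) ^ 2"
  proof (rule sums_nabs_le)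
    fix n
    show "nabs (?x ^ n / fact n + ?g n) \<le> nabs (of_nat a :: 'a) ^ 2"
    proof (cases "n < 2")
      case False
      have "nabs (?x ^ n / fact n) = nabs (of_nat a :: 'a) ^ n * nabs (x ^ n / fact n)"
        by (simp add: power_mult_distrib nabs_mult nabs_divide nabs_power)
      also have "\<dots> \<le> nabs (of_nat a :: 'a) ^ n"
        using nabs_exp_term_le_1[OF assms] by (intro mult_left_le) auto
      also have "\<dots> \<le> nabs (of_nat a :: 'a) ^ 2"
        using False by (intro power_decreasing nabs_of_nat_le_1) auto
      finally show ?thesis using False by simp
    qed (auto simp: less_2_cases_iff)
  qed
  then show ?thesis by (simp add: algebra_simps)
qed

text \<open>
  Adjacent terms add up: \<open>C(a-1,k) + C(a-1,k+1) = C(a,k+1) = a/(k+1) C(a-1,k)\<close> is divisible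
  by \<open>a\<close> up to the denominator \<open>k+1\<close>.  So \<open>C(a-1,k)\<close> is close to \<open>(-1)\<^sup>k\<close> when \<open>a\<close> is \<open>p\<close>-adically
  small, with denominators accumulating to at most \<open>k!\<close>.  The lemma writes \<open>Suc a\<close> for this \<open>a\<close>.
\<close>

lemma nabs_binomial_alternating:
  "nabs (of_nat (a choose k) - (-1) ^ k :: 'a) \<le> nabs (of_nat (Suc a) :: 'a) / nabs (fact k :: 'a)"
proof (induction k)
  case (Suc k)
  let ?A = "nabs (of_nat (Suc a) :: 'a)"
  have f: "nabs (fact k :: 'a) \<noteq> 0" "nabs (fact (Suc k) :: 'a) \<noteq> 0"
    by (simp_all del: fact_Suc)
  have le: "nabs (fact (Suc k) :: 'a) \<le> nabs (of_nat (Suc k) :: 'a)"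
    "nabs (fact (Suc k) :: 'a) \<le> nabs (fact k :: 'a)"
    using nabs_fact_le_1[of k] nabs_of_nat_le_1[of "Suc k", where 'a = 'a]
    by (auto simp: nabs_mult mult_left_le mult_left_le_one_le simp del: of_nat_Suc)
  have "of_nat (a choose Suc k) - (-1) ^ Suc k =
      (of_nat (Suc a choose Suc k) - (of_nat (a choose k) - (-1) ^ k) :: 'a)"
    by simp
  also have "nabs \<dots> \<le> ?A / nabs (fact (Suc k) :: 'a)"
  proof (rule nabs_diff_le)
    have "of_nat (Suc k) * of_nat (Suc a choose Suc k) = (of_nat (Suc a) * of_nat (a choose k) :: 'a)"
      by (metis Suc_times_binomial of_nat_mult)
    then have "of_nat (Suc a choose Suc k) = (of_nat (Suc a) / of_nat (Suc k) * of_nat (a choose k) :: 'a)"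
      by (simp add: field_simps del: of_nat_Suc binomial_Suc_Suc)
    then have "nabs (of_nat (Suc a choose Suc k) :: 'a) =
        ?A / nabs (of_nat (Suc k) :: 'a) * nabs (of_nat (a choose k) :: 'a)"
      by (simp only: nabs_mult nabs_divide)
    also have "\<dots> \<le> ?A / nabs (of_nat (Suc k) :: 'a)"
      using nabs_of_nat_le_1 by (intro mult_left_le) auto
    also have "\<dots> \<le> ?A / nabs (fact (Suc k) :: 'a)"
      using le(1) f by (intro divide_left_mono mult_pos_pos nabs_pos) (auto simp del: of_nat_Suc fact_Suc)
    finally show "nabs (of_nat (Suc a choose Suc k) :: 'a) \<le> ?A / nabs (fact (Suc k) :: 'a)" .
    have "?A / nabs (fact k :: 'a) \<le> ?A / nabs (fact (Suc k) :: 'a)"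
      using le(2) f by (intro divide_left_mono mult_pos_pos nabs_pos) (auto simp del: fact_Suc)
    with Suc show "nabs (of_nat (a choose k) - (-1) ^ k :: 'a) \<le> ?A / nabs (fact (Suc k) :: 'a)"
      by linarith
  qed
  finally show ?case .
qed simp

text \<open>
  This makes precise that \<open>(y\<^sup>a - 1) / a\<close> approaches \<open>log y\<close>: the binomial expansion of \<open>y\<^sup>a = (1 + t)\<^sup>a\<close> gives
  \<open>(y\<^sup>a - 1) / a = \<Sum> C(a-1,k) t\<^bsup>k+1\<^esup>/(k+1)\<close>, whose coefficients differ from those of the
  logarithm by \<open>C(a-1,k) - (-1)\<^sup>k\<close>.  The factor \<open>k!\<close> lost in estimating this difference turns
  \<open>t\<^bsup>k+1\<^esup>/(k+1)\<close> into the bounded exponential term \<open>t\<^bsup>k+1\<^esup>/(k+1)!\<close>.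
  Here too the lemma has \<open>Suc a\<close> in place of \<open>a\<close>.
\<close>

lemma nlog_expansion:
  fixes y :: 'a
  assumes "nabs (y - 1) < \<rho>"
  shows "nabs (y ^ Suc a - 1 - of_nat (Suc a) * nlog y) \<le> nabs (of_nat (Suc a) :: 'a) ^ 2"
proof -
  define t where "t = y - 1"
  let ?A = "of_nat (Suc a) :: 'a"
  let ?f = "\<lambda>k. of_nat (a choose k) * (t ^ Suc k / of_nat (Suc k))"
  let ?l = "\<lambda>k. (-1) ^ k * t ^ Suc k / of_nat (Suc k)"
  have "y ^ Suc a = (t + 1) ^ Suc a" by (simp add: t_def)
  also have "\<dots> = (\<Sum>k\<le>Suc a. of_nat (Suc a choose k) * t ^ k)"
    by (simp only: binomial_ring power_one mult_1_right)
  also have "\<dots> = 1 + (\<Sum>k\<le>a. of_nat (Suc a choose Suc k) * t ^ Suc k)"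
    by (subst sum.atMost_Suc_shift) simp
  also have "(\<Sum>k\<le>a. of_nat (Suc a choose Suc k) * t ^ Suc k) = ?A * sum ?f {..a}"
    unfolding sum_distrib_left
  proof (rule sum.cong[OF refl])
    fix k
    have "of_nat (Suc k) * of_nat (Suc a choose Suc k) = (?A * of_nat (a choose k) :: 'a)"
      by (metis Suc_times_binomial of_nat_mult)
    then have "of_nat (Suc a choose Suc k) = (?A * of_nat (a choose k) / of_nat (Suc k) :: 'a)"
      by (simp add: field_simps del: of_nat_Suc binomial_Suc_Suc)
    then show "of_nat (Suc a choose Suc k) * t ^ Suc k = ?A * ?f k" by simp
  qed
  finally have y: "y ^ Suc a - 1 = ?A * sum ?f {..a}" by simp
  have "?f sums sum ?f {..a}" by (intro sums_finite) (auto simp: binomial_eq_0)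
  moreover have "(\<lambda>k. - ?l k) sums - nlog y"
    using nlog_sums[OF assms] unfolding sums_def t_def sum_negf by (intro tendsto_minus)
  ultimately have "(\<lambda>k. ?f k + - ?l k) sums (sum ?f {..a} + - nlog y)"
    by (rule sums_add)
  then have "nabs (sum ?f {..a} + - nlog y) \<le> nabs ?A"
  proof (rule sums_nabs_le)
    fix k
    have "?f k + - ?l k = (of_nat (a choose k) - (-1) ^ k) * fact k * (t ^ Suc k / fact (Suc k))"
      by (simp add: field_simps del: of_nat_Suc)
    also have "nabs \<dots> = nabs (of_nat (a choose k) - (-1) ^ k :: 'a) * nabs (fact k :: 'a)
        * nabs (t ^ Suc k / fact (Suc k))"
      by (simp only: nabs_mult)
    also have "\<dots> \<le> nabs (of_nat (a choose k) - (-1) ^ k :: 'a) * nabs (fact k :: 'a)"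
      using nabs_exp_term_le_1[of t "Suc k"] assms by (intro mult_left_le) (auto simp: t_def)
    also have "\<dots> \<le> nabs ?A"
      using nabs_binomial_alternating[of a k] nabs_pos[of "fact k :: 'a"]
      by (simp add: field_simps del: of_nat_Suc)
    finally show "nabs (?f k + - ?l k) \<le> nabs ?A" .
  qed
  then have "nabs ?A * nabs (sum ?f {..a} + - nlog y) \<le> nabs ?A * nabs ?A"
    by (intro mult_left_mono) auto
  moreover have "y ^ Suc a - 1 - ?A * nlog y = ?A * (sum ?f {..a} + - nlog y)"
    unfolding y by (simp add: algebra_simps)
  ultimately show ?thesis
    by (simp only: nabs_mult power2_eq_square)
qed

lemma nlog_expansion_p_power:
  fixes y :: 'a
  assumes "nabs (y - 1) < \<rho>"
  shows "nabs (y ^ (p ^ N) - 1 - of_nat (p ^ N) * nlog y) \<le> nabs (of_nat (p ^ N) :: 'a) ^ 2"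
proof -
  have "p ^ N = Suc (p ^ N - 1)" using p_gt_1 by simp
  then show ?thesis using nlog_expansion[OF assms] by metis
qed

lemma nabs_p_power: "nabs (of_nat (p ^ N) :: 'a) = (1 / real p) ^ N"
  by (simp add: nabs_power nabs_p)

lemma nabs_p_power_tendsto: "(\<lambda>N. nabs (of_nat (p ^ N) :: 'a)) \<longlonglongrightarrow> 0"
  unfolding nabs_p_power using p_gt_1 by (intro LIMSEQ_realpow_zero) auto

text \<open>
  Put \<open>E = exp (log y)\<close> and \<open>u = y / E\<close>.  The two expansions above show that \<open>y\<^sup>a\<close> and \<open>E\<^sup>a\<close>
  agree modulo \<open>a\<^sup>2\<close> for \<open>a = p\<^sup>N\<close>.  Hence \<open>u\<^sup>a - 1\<close>, and with it \<open>a log u\<close>, is divisible by \<open>a\<^sup>2\<close>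
  for all \<open>N\<close>, which forces \<open>log u = 0\<close> and \<open>u = 1\<close>.
\<close>

lemma nexp_nlog:
  fixes y :: 'a
  assumes y: "nabs (y - 1) < \<rho>"
  shows "nexp (nlog y) = y"
proof -
  define L where "L = nlog y"
  define E where "E = nexp L"
  define u where "u = y / E"
  have L: "nabs L < \<rho>" using nabs_nlog_le[OF y] y by (simp add: L_def)
  have E1: "nabs (E - 1) < \<rho>"
  proof -
    have "(\<lambda>n. L ^ n / fact n + (if n = 0 then - 1 else 0)) sums (E + - 1)"
      using nexp_sums[OF L] sums_If_finite[of "\<lambda>n. n = 0" "\<lambda>_. - 1 :: 'a"]
      by (intro sums_add) (auto simp: E_def)
    then have "nabs (E + - 1) \<le> nabs L"
    proof (rule sums_nabs_le)
      fix n show "nabs (L ^ n / fact n + (if n = 0 then - 1 else 0)) \<le> nabs L"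
      proof (cases n)
        case (Suc k)
        have "(nabs L / \<rho>) ^ k \<le> 1" using L rho_pos by (intro power_le_one) auto
        then show ?thesis
          using nabs_exp_term_le[of L k] Suc mult_left_le[of _ "nabs L"] by fastforce
      qed simp
    qed
    with L show ?thesis by simp
  qed
  have E: "nabs E = 1"
    using nabs_eq_if_close[of E 1] E1 rho_lt_1 by simp
  then have "E \<noteq> 0" by auto
  have "u - 1 = ((y - 1) - (E - 1)) / E" using \<open>E \<noteq> 0\<close> by (simp add: u_def field_simps)
  then have "nabs (u - 1) = nabs ((y - 1) - (E - 1))" using E by (simp add: nabs_divide)
  also have "\<dots> \<le> max (nabs (y - 1)) (nabs (E - 1))" by (rule nabs_diff_le) simp_all
  finally have u: "nabs (u - 1) < \<rho>" using y E1 by simp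
  have "nabs (nlog u) \<le> nabs (of_nat (p ^ N) :: 'a)" for N
  proof -
    define a where "a = p ^ N"
    let ?A = "of_nat a :: 'a"
    have "0 < nabs ?A" using p_gt_1 by (intro nabs_pos) (simp add: a_def)
    have "y ^ a - E ^ a = (y ^ a - 1 - ?A * L) - (nexp (?A * L) - 1 - ?A * L)"
      using nexp_of_nat_mult[OF L] by (simp add: E_def)
    also have "nabs \<dots> \<le> nabs ?A ^ 2"
      unfolding a_def L_def
      by (rule nabs_diff_le[OF nlog_expansion_p_power[OF y] nexp_expansion[OF L[unfolded L_def]]])
    finally have "nabs (y ^ a - E ^ a) \<le> nabs ?A ^ 2" .
    moreover have "u ^ a - 1 = (y ^ a - E ^ a) / E ^ a"
      using \<open>E \<noteq> 0\<close> by (simp add: u_def power_divide diff_divide_distrib)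
    ultimately have "nabs (u ^ a - 1) \<le> nabs ?A ^ 2"
      by (simp add: nabs_divide nabs_power E)
    moreover have "nabs (u ^ a - 1 - ?A * nlog u) \<le> nabs ?A ^ 2"
      using nlog_expansion_p_power[OF u] by (simp add: a_def)
    ultimately have "nabs ((u ^ a - 1) - (u ^ a - 1 - ?A * nlog u)) \<le> nabs ?A ^ 2"
      by (rule nabs_diff_le)
    then have "nabs ?A * nabs (nlog u) \<le> nabs ?A * nabs ?A"
      by (simp add: nabs_mult power2_eq_square)
    with \<open>0 < nabs ?A\<close> show ?thesis by (simp add: a_def)
  qed
  then have "nabs (nlog u) \<le> 0"
    using LIMSEQ_le_const[OF nabs_p_power_tendsto] by blast
  then have "nlog u = 0" using nabs_nonneg nabs_eq_0_iff order_antisym by metis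
  with u have "u = 1" by (rule nlog_eq_0_imp)
  then show ?thesis by (simp add: u_def E_def L_def split: if_splits)
qed


section \<open>Powers of \<open>q\<close>\<close>

context
  fixes q :: 'a
  assumes q: "nabs (q - 1) < \<rho>"
begin

lemma nabs_nlog_q: "nabs (nlog q) < \<rho>"
  using nabs_nlog_le[OF q] q by linarith

lemma qpow_of_nat: "qpow q (of_nat i) = q ^ i"
  by (simp add: qpow_def nexp_of_nat_mult nabs_nlog_q nexp_nlog q)

lemma power_mult_qpow_minus: "q ^ i * qpow q (- of_nat i) = 1"
proof -
  have "nabs (of_nat i * nlog q) < \<rho>"
    using nabs_of_nat_mult_le[of i "nlog q"] nabs_nlog_q by linarith
  then show ?thesis
    using nexp_minus[of "of_nat i * nlog q"] qpow_of_nat[of i] by (simp add: qpow_def mult.commute)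
qed

lemma qnum_of_nat: "qnum q (of_nat i) = (1 - q ^ i) / (1 - q)"
  by (simp add: qnum_def qpow_of_nat)

lemma nabs_power_minus_1_le: "nabs (q ^ k - 1) \<le> nabs (q - 1)"
proof -
  have "nabs q = 1" using nabs_eq_if_close[of q 1] q rho_lt_1 by simp
  then have "nabs (\<Sum>l<k. q ^ l) \<le> 1"
    by (intro nabs_sum_le) (auto simp: nabs_power)
  then show ?thesis by (simp add: power_diff_1_eq nabs_mult mult_left_le)
qed

lemma difference_quotient_tendsto_nlog:
  "(\<lambda>N. (q ^ (p ^ N) - 1) / of_nat (p ^ N)) \<longlonglongrightarrow> nlog q"
proof (rule tendsto_nabs_squeeze[OF nabs_p_power_tendsto], intro always_eventually allI)
  fix N
  let ?a = "of_nat (p ^ N) :: 'a"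
  have "?a \<noteq> 0" using p_gt_1 by simp
  then have "(q ^ (p ^ N) - 1) / ?a - nlog q = (q ^ (p ^ N) - 1 - ?a * nlog q) / ?a"
    by (simp add: field_simps)
  moreover have "nabs (q ^ (p ^ N) - 1 - ?a * nlog q) \<le> nabs ?a * nabs ?a"
    using nlog_expansion_p_power[OF q] by (simp add: power2_eq_square)
  ultimately show "nabs ((q ^ (p ^ N) - 1) / ?a - nlog q) \<le> nabs ?a"
    using nabs_pos[OF \<open>?a \<noteq> 0\<close>] by (simp only: nabs_divide pos_divide_le_eq)
qed

lemma p_power_power_tendsto_1: "(\<lambda>N. q ^ (p ^ N)) \<longlonglongrightarrow> 1"
proof -
  have "(\<lambda>N. of_nat (p ^ N) * ((q ^ (p ^ N) - 1) / of_nat (p ^ N)) + 1) \<longlonglongrightarrow> 0 * nlog q + 1"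
    using nabs_p_power_tendsto
    by (intro tendsto_add tendsto_mult difference_quotient_tendsto_nlog tendsto_const)
       (simp add: tendsto_nabs_iff)
  then show ?thesis using p_gt_1 by simp
qed

lemma geometric_sum_tendsto: "(\<lambda>N. \<Sum>l<k. (q ^ (p ^ N)) ^ l) \<longlonglongrightarrow> of_nat k"
proof -
  have "(\<lambda>N. (q ^ (p ^ N)) ^ l) \<longlonglongrightarrow> 1 ^ l" for l
    by (intro tendsto_power_strong p_power_power_tendsto_1 tendsto_const)
  then have "(\<lambda>N. \<Sum>l<k. (q ^ (p ^ N)) ^ l) \<longlonglongrightarrow> (\<Sum>l<k. 1 ^ l)"
    by (rule tendsto_sum)
  then show ?thesis by simp
qed

text \<open>
  If \<open>q\<^sup>k = 1\<close>, then \<open>0 = (q\<^bsup>ka\<^esup> - 1) / a = (q\<^sup>a - 1) / a \<cdot> \<Sum>\<^bsub>l<k\<^esub> q\<^bsup>la\<^esup>\<close> for \<open>a = p\<^sup>N\<close>,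
  which tends to \<open>k log q\<close>.
\<close>

lemma power_neq_1:
  assumes "q \<noteq> 1" "0 < k"
  shows "q ^ k \<noteq> 1"
proof
  assume eq: "q ^ k = 1"
  have "(q ^ (p ^ N) - 1) / of_nat (p ^ N) * (\<Sum>l<k. (q ^ (p ^ N)) ^ l) = 0" for N
  proof -
    have "(q ^ (p ^ N) - 1) * (\<Sum>l<k. (q ^ (p ^ N)) ^ l) = (q ^ (p ^ N)) ^ k - 1"
      by (simp add: power_diff_1_eq)
    also have "(q ^ (p ^ N)) ^ k = (q ^ k) ^ (p ^ N)"
      by (simp flip: power_mult add: mult.commute)
    finally show ?thesis using eq by simp
  qed
  then have "(\<lambda>N. 0) \<longlonglongrightarrow> nlog q * of_nat k"
    using tendsto_mult[OF difference_quotient_tendsto_nlog geometric_sum_tendsto[of k]] by (simp only:)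
  then have "nlog q * of_nat k = 0"
    using LIMSEQ_unique[OF tendsto_const] by metis
  then show False using assms nlog_eq_0_imp[OF q] by simp
qed

section \<open>Existence of the \<open>q\<close>-Bernoulli numbers\<close>

text \<open>
  With \<open>a = p\<^sup>N\<close>, the geometric sum turns the expression for \<open>k > 0\<close> into
  \<open>(q - 1) / (q\<^sup>k - 1) \<cdot> (q\<^bsup>ka\<^esup> - 1) / (q\<^sup>a - 1)\<close>, whose second factor is
  \<open>\<Sum>\<^bsub>l<k\<^esub> q\<^bsup>la\<^esup> \<rightarrow> k\<close>.  For \<open>k = 0\<close> the value \<open>a (q - 1) / (q\<^sup>a - 1)\<close> tends to
  \<open>(q - 1) / log q\<close>.
\<close>

lemma convergent_volkenborn_power:
  assumes "q \<noteq> 1"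
  shows "convergent (\<lambda>N. 1 / qnum q (of_nat (p ^ N)) * (\<Sum>i | i < p ^ N. (q ^ i) ^ k))"
proof (cases "k = 0")
  case True
  have "(\<lambda>N. (q - 1) * inverse ((q ^ (p ^ N) - 1) / of_nat (p ^ N)))
      \<longlonglongrightarrow> (q - 1) * inverse (nlog q)"
    using nlog_eq_0_imp[OF q] assms
    by (intro tendsto_mult tendsto_const tendsto_inverse_nonarch
        difference_quotient_tendsto_nlog) auto
  moreover have "1 / qnum q (of_nat (p ^ N)) * (\<Sum>i | i < p ^ N. (q ^ i) ^ k) =
      (q - 1) * inverse ((q ^ (p ^ N) - 1) / of_nat (p ^ N))" for N
    using power_neq_1[OF assms, of "p ^ N"] p_gt_1 True assms
    by (simp add: qnum_of_nat field_simps del: of_nat_power)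
  ultimately show ?thesis by (simp add: convergent_def) blast
next
  case False
  have "(\<lambda>N. (q - 1) / (q ^ k - 1) * (\<Sum>l<k. (q ^ (p ^ N)) ^ l))
      \<longlonglongrightarrow> (q - 1) / (q ^ k - 1) * of_nat k"
    by (intro tendsto_mult tendsto_const geometric_sum_tendsto)
  moreover have "1 / qnum q (of_nat (p ^ N)) * (\<Sum>i | i < p ^ N. (q ^ i) ^ k) =
      (q - 1) / (q ^ k - 1) * (\<Sum>l<k. (q ^ (p ^ N)) ^ l)" for N
  proof -
    have ne: "q ^ k \<noteq> 1" "q ^ (p ^ N) \<noteq> 1"
      using power_neq_1[OF assms] False p_gt_1 by auto
    have "(\<Sum>i | i < p ^ N. (q ^ i) ^ k) = (\<Sum>i<p ^ N. (q ^ k) ^ i)"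
      by (simp add: lessThan_def mult.commute flip: power_mult)
    also have "\<dots> = ((q ^ (p ^ N)) ^ k - 1) / (q ^ k - 1)"
      using geometric_sum[OF ne(1), of "p ^ N"] by (simp add: mult.commute flip: power_mult)
    also have "(q ^ (p ^ N)) ^ k - 1 = (q ^ (p ^ N) - 1) * (\<Sum>l<k. (q ^ (p ^ N)) ^ l)"
      by (rule power_diff_1_eq)
    finally have "(\<Sum>i | i < p ^ N. (q ^ i) ^ k) =
        (q ^ (p ^ N) - 1) * (\<Sum>l<k. (q ^ (p ^ N)) ^ l) / (q ^ k - 1)" .
    moreover have "1 / qnum q (of_nat (p ^ N)) * (q ^ (p ^ N) - 1) = q - 1"
      using ne assms by (simp add: qnum_of_nat field_simps del: of_nat_power)
    ultimately show ?thesis by (simp add: mult.assoc[symmetric])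
  qed
  ultimately show ?thesis by (simp add: convergent_def) blast
qed

text \<open>
  The factors \<open>q\<^sup>i\<close> and \<open>q\<^bsup>-i\<^esup>\<close> cancel, and \<open>[i]\<^sup>m\<close> is a polynomial in \<open>q\<^sup>i\<close>, so the previous
  lemma yields convergence.
\<close>

lemma qbernoulli_LIMSEQ:
  assumes "q \<noteq> 1"
  shows "(\<lambda>N. 1 / qnum q (of_nat (p ^ N)) * (\<Sum>i | i < p ^ N. qnum q (of_nat i) ^ m))
    \<longlonglongrightarrow> qbernoulli p q m" (is "?B \<longlonglongrightarrow> _")
proof -
  let ?T = "\<lambda>k N. 1 / qnum q (of_nat (p ^ N)) * (\<Sum>i | i < p ^ N. (q ^ i) ^ k)"
  let ?c = "\<lambda>k. of_nat (m choose k) * (-1) ^ k / (1 - q) ^ m"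
  have poly: "qnum q (of_nat i) ^ m = (\<Sum>k\<le>m. ?c k * (q ^ i) ^ k)" for i
  proof -
    have "(1 - q ^ i) ^ m = (- (q ^ i) + 1) ^ m" by simp
    also have "\<dots> = (\<Sum>k\<le>m. of_nat (m choose k) * (- (q ^ i)) ^ k)"
      by (simp only: binomial_ring power_one mult_1_right)
    also have "\<dots> = (\<Sum>k\<le>m. of_nat (m choose k) * (-1) ^ k * (q ^ i) ^ k)"
      by (intro sum.cong refl) (metis mult.assoc power_minus)
    finally show ?thesis
      by (simp add: qnum_of_nat power_divide sum_divide_distrib)
  qed
  have B: "?B = (\<lambda>N. \<Sum>k\<le>m. ?c k * ?T k N)"
  proof
    fix N
    have "(\<Sum>i | i < p ^ N. qnum q (of_nat i) ^ m) = (\<Sum>k\<le>m. ?c k * (\<Sum>i | i < p ^ N. (q ^ i) ^ k))"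
      unfolding poly sum_distrib_left by (rule sum.swap)
    then show "?B N = (\<Sum>k\<le>m. ?c k * ?T k N)"
      by (simp only: sum_distrib_left[of "1 / _"] mult.left_commute[of "1 / _"])
  qed
  have "?T k \<longlonglongrightarrow> lim (?T k)" for k
    using convergent_volkenborn_power[OF assms, of k] by (simp only: convergent_LIMSEQ_iff)
  then have "?B \<longlonglongrightarrow> (\<Sum>k\<le>m. ?c k * lim (?T k))"
    unfolding B by (intro tendsto_sum tendsto_mult tendsto_const)
  moreover have "qbernoulli p q m = lim ?B"
    unfolding qbernoulli_def volkenborn_def
    by (simp only: mult.assoc[symmetric] power_mult_qpow_minus mult_1_left)
  ultimately show ?thesis by (simp only: limI)
qed

end

end

section \<open>Splitting off the multiples of \<open>p\<close>\<close>

lemma sum_not_dvd: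
  fixes f :: "nat \<Rightarrow> 'b::ab_group_add"
  assumes "0 < p"
  shows "(\<Sum>i | i < p * M \<and> \<not> p dvd i. f i) = (\<Sum>i | i < p * M. f i) - (\<Sum>i | i < M. f (p * i))"
proof -
  have "(\<Sum>i | i < M. f (p * i)) = sum f ((*) p ` {i. i < M})"
    using assms by (subst sum.reindex) (auto intro: inj_onI)
  also have "(*) p ` {i. i < M} = {i. i < p * M \<and> p dvd i}"
    using assms by (auto elim!: dvdE)
  finally have dvd: "(\<Sum>i | i < M. f (p * i)) = (\<Sum>i | i < p * M \<and> p dvd i. f i)" .
  have "{i. i < p * M \<and> \<not> p dvd i} = {i. i < p * M} - {i. i < p * M \<and> p dvd i}" by auto
  then show ?thesis unfolding dvd by (simp add: sum_diff Collect_mono)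
qed

text \<open>
  The statement at finite level: \<open>[p i] = [p] [i : q\<^sup>p]\<close> pulls \<open>[p]\<^sup>m\<close> out of the sum over the
  multiples of \<open>p\<close>, and \<open>[p\<^bsup>N+1\<^esup>] = [p] [p\<^sup>N : q\<^sup>p]\<close> takes one factor back, which leaves
  \<open>[p]\<^bsup>m-1\<^esup>\<close>.
\<close>

lemma (in complete_padic_field) units_sum_eq:
  fixes q :: 'a
  assumes q: "nabs (q - 1) < \<rho>" "q \<noteq> 1" and "1 \<le> m"
  shows "1 / qnum q (of_nat (p ^ Suc N)) *
      (\<Sum>i | i < p ^ Suc N \<and> \<not> p dvd i. qnum q (of_nat i) ^ m) =
    1 / qnum q (of_nat (p ^ Suc N)) * (\<Sum>i | i < p ^ Suc N. qnum q (of_nat i) ^ m) -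
    qnum q (of_nat p) ^ (m - 1) *
      (1 / qnum (q ^ p) (of_nat (p ^ N)) * (\<Sum>i | i < p ^ N. qnum (q ^ p) (of_nat i) ^ m))"
proof -
  have qp: "nabs (q ^ p - 1) < \<rho>" "q ^ p \<noteq> 1"
    using nabs_power_minus_1_le[OF q(1), of p] q power_neq_1[OF q] p_gt_1 by auto
  have mult: "qnum q (of_nat (p * i)) = qnum q (of_nat p) * qnum (q ^ p) (of_nat i)" for i
    using q(2) qp(2) qnum_of_nat[OF q(1)] qnum_of_nat[OF qp(1)]
    by (simp add: power_mult del: of_nat_mult)
  have p0: "qnum q (of_nat p) \<noteq> 0"
    using q(2) qp(2) by (simp add: qnum_of_nat[OF q(1)])
  have "x ^ m / x = x ^ (m - 1)" if "x \<noteq> 0" for x :: 'a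
    using that \<open>1 \<le> m\<close> by (cases m) auto
  note cancel = this[OF p0]
  have "1 / qnum q (of_nat (p ^ Suc N)) * (\<Sum>i | i < p ^ N. qnum q (of_nat (p * i)) ^ m) =
      qnum q (of_nat p) ^ m / qnum q (of_nat p) *
      (1 / qnum (q ^ p) (of_nat (p ^ N)) * (\<Sum>i | i < p ^ N. qnum (q ^ p) (of_nat i) ^ m))"
    unfolding mult power_Suc power_mult_distrib sum_distrib_left[symmetric] by simp
  then show ?thesis
    unfolding cancel using p_gt_1
    by (simp only: power_Suc sum_not_dvd right_diff_distrib)
qed

theorem theorem2:
  fixes p n j :: nat and q :: "'a::nonarch_field"
  assumes "prime p"
    and "is_Cp p TYPE('a)"
    and "q \<noteq> 1"
    and "nabs (q - 1) < real p powr (- 1 / (real p - 1))"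
    and "n \<ge> 1"
    and "j \<ge> 1"
    and "j \<le> p - 1"
  shows "qzeta p q j (of_nat n) =
    1 / of_nat (j + (p - 1) * n) *
      (qbernoulli p q (j + (p - 1) * n) -
       qnum q (of_nat p) ^ (j + (p - 1) * n - 1) * qbernoulli p (q ^ p) (j + (p - 1) * n))"
proof -
  interpret complete_padic_field p "TYPE('a)"
    using assms(1,2) by unfold_locales (auto simp: is_Cp_def)
  have q: "nabs (q - 1) < \<rho>"
    using assms(4) by (simp add: \<rho>_def)
  have qp: "nabs (q ^ p - 1) < \<rho>" "q ^ p \<noteq> 1"
    using nabs_power_minus_1_le[OF q, of p] q power_neq_1[OF q assms(3)] p_gt_1 by auto
  define m where "m = j + (p - 1) * n"
  have "1 \<le> m" using assms(6) by (simp add: m_def)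
  let ?U = "\<lambda>N. 1 / qnum q (of_nat (p ^ N)) *
    (\<Sum>i | i < p ^ N \<and> \<not> p dvd i. qnum q (of_nat i) ^ m)"
  have "(\<lambda>N. ?U (Suc N)) \<longlonglongrightarrow>
      qbernoulli p q m - qnum q (of_nat p) ^ (m - 1) * qbernoulli p (q ^ p) m"
    unfolding units_sum_eq[OF q assms(3) \<open>1 \<le> m\<close>]
    by (intro tendsto_diff tendsto_mult tendsto_const qbernoulli_LIMSEQ[OF qp]
        LIMSEQ_Suc[OF qbernoulli_LIMSEQ[OF q assms(3)]])
  \<comment> \<open>The splitting relates level \<open>N + 1\<close> for \<open>q\<close> to level \<open>N\<close> for \<open>q\<^sup>p\<close>, hence the index shift.\<close>
  then have "lim ?U = qbernoulli p q m - qnum q (of_nat p) ^ (m - 1) * qbernoulli p (q ^ p) m"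
    by (intro limI) (rule LIMSEQ_imp_Suc)
  moreover have "volkenborn_units p q (\<lambda>x. qpow q (- x) * qnum q x ^ j *
      binpow (qnum q x ^ (p - 1)) (of_nat n)) = lim ?U"
    unfolding volkenborn_units_def binpow_of_nat power_mult[symmetric] mult.assoc power_add[symmetric]
    unfolding mult.assoc[symmetric] power_mult_qpow_minus[OF q] mult_1_left m_def ..
  ultimately show ?thesis
    by (simp add: qzeta_def m_def)
qed

end
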